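(* Let $q\in\mathbb{C}$ with $|q|=1$, $q\ne\pm1,\pm i$, and let $\lambda_{12},\lambda_{13},\lambda_{23}\in\mathbb{C}$ satisfy $$\lambda_{12}\lambda_{23}-\lambda_{12}\lambda_{13}-\lambda_{13}\lambda_{23}=-1 .$$ Let $A'_\lambda$ be the unital complex algebra with three generators $v_1,v_2,v_3$ and relations $$[v_j,v_i]=\frac{q^2-1}{q^2+1}\bigl(v_j^2-v_i^2-\lambda_{ij}(v_i-v_j)^2\bigr),\qquad 1\le i<j\le 3 .$$ Then $A'_\lambda$ is polynomial.
   Context: $[x,y]=xy-yx$. The defining relations are homogeneous, so $A'_\lambda$ is graded by degree. The algebra is called polynomial if its subspaces of homogeneous polynomials have the classical dimensions, i.e. for every $d\ge 0$ the homogeneous component of degree $d$ has the same dimension as the space of homogeneous polynomials of degree $d$ in three commuting variables, $\binom{d+2}{2}$. *)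

theory Defs
  imports Complex_Main "HOL-Library.Poly_Mapping" "HOL-Algebra.Embedded_Algebras"
    "HOL-Algebra.QuotRing"
begin

text \<open>
  The free unital complex algebra on \<^typ>\<open>'a\<close> is the monoid algebra of the free monoid on
  \<^typ>\<open>'a\<close>.  Words are a copy of lists whose addition is concatenation, so that the convolution
  product of \<^theory>\<open>HOL-Library.Poly_Mapping\<close> is the product of noncommutative polynomials.
\<close>

datatype 'a word = Word (letters: "'a list")

instantiation word :: (type) monoid_add
begin

definition zero_word :: "'a word" where
  "zero_word = Word []"

definition plus_word :: "'a word \<Rightarrow> 'a word \<Rightarrow> 'a word" where
  "plus_word u w = Word (letters u @ letters w)"

instance
  by standard (simp_all add: zero_word_def plus_word_def)

end

type_synonym 'a ncpoly = "'a word \<Rightarrow>\<^sub>0 complex"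

definition const :: "complex \<Rightarrow> 'a ncpoly" where
  "const c = Poly_Mapping.single 0 c"

definition gen :: "'a \<Rightarrow> 'a ncpoly" where
  "gen a = Poly_Mapping.single (Word [a]) 1"

definition homogeneous :: "nat \<Rightarrow> 'a ncpoly set" where
  "homogeneous d = {p. \<forall>w \<in> Poly_Mapping.keys p. length (letters w) = d}"

definition free_algebra :: "'a ncpoly ring" where
  "free_algebra = \<lparr>carrier = UNIV, mult = (*), one = 1, zero = 0, add = (+)\<rparr>"

lemma ring_free_algebra: "ring (free_algebra :: 'a ncpoly ring)"
proof (rule ringI)
  show "abelian_group (free_algebra :: 'a ncpoly ring)"
  proof (rule abelian_groupI)
    fix x :: "'a ncpoly"
    assume "x \<in> carrier free_algebra"
    show "\<exists>y\<in>carrier free_algebra. y \<oplus>\<^bsub>free_algebra\<^esub> x = \<zero>\<^bsub>free_algebra\<^esub>"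
      by (rule bexI[of _ "- x"]) (simp_all add: free_algebra_def)
  qed (simp_all add: free_algebra_def algebra_simps)
  show "monoid (free_algebra :: 'a ncpoly ring)"
    by (rule monoidI) (simp_all add: free_algebra_def algebra_simps)
qed (simp_all add: free_algebra_def algebra_simps)

text \<open>\<^const>\<open>genideal\<close> is the two-sided ideal generated by a set, also over noncommutative rings.\<close>

definition relation_ideal :: "'a ncpoly set \<Rightarrow> 'a ncpoly set" where
  "relation_ideal S = Idl\<^bsub>free_algebra\<^esub> S"

definition presented_algebra :: "'a ncpoly set \<Rightarrow> 'a ncpoly set ring" where
  "presented_algebra S = free_algebra Quot relation_ideal S"

definition residue_class :: "'a ncpoly set \<Rightarrow> 'a ncpoly \<Rightarrow> 'a ncpoly set" where
  "residue_class S p = relation_ideal S +>\<^bsub>free_algebra\<^esub> p"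

lemma ideal_relation_ideal: "ideal (relation_ideal S) free_algebra"
  unfolding relation_ideal_def
  by (rule ring.genideal_ideal[OF ring_free_algebra]) (simp add: free_algebra_def)

lemma ring_presented_algebra: "ring (presented_algebra S)"
  unfolding presented_algebra_def
  by (rule ideal.quotient_is_ring[OF ideal_relation_ideal])

definition scalars :: "'a ncpoly set \<Rightarrow> 'a ncpoly set set" where
  "scalars S = residue_class S ` range const"

lemma subfield_scalars:
  assumes "\<one>\<^bsub>presented_algebra S\<^esub> \<noteq> \<zero>\<^bsub>presented_algebra S\<^esub>"
  shows "subfield (scalars S) (presented_algebra S)"
proof -
  let ?F = "free_algebra :: 'a ncpoly ring"
  interpret F: ring ?F by (rule ring_free_algebra)
  have hom: "ring_hom_ring ?F (presented_algebra S) (residue_class S)"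
    using ideal.rcos_ring_hom_ring[OF ideal_relation_ideal[of S]]
    by (simp add: presented_algebra_def residue_class_def[abs_def])
  have minus: "\<ominus>\<^bsub>?F\<^esub> x = - x" for x
    by (rule F.minus_equality) (simp_all add: free_algebra_def)
  have mul: "const a * const b = (const (a * b) :: 'a ncpoly)" for a b
    by (simp add: const_def mult_single)
  have sr: "subring (range const) ?F"
  proof (rule F.subringI)
    fix h1 h2 :: "'a ncpoly"
    assume h: "h1 \<in> range const" "h2 \<in> range const"
    then show "h1 \<otimes>\<^bsub>?F\<^esub> h2 \<in> range const"
      by (auto simp: free_algebra_def mul)
    from h show "h1 \<oplus>\<^bsub>?F\<^esub> h2 \<in> range const"
      by (auto simp: free_algebra_def const_def single_add[symmetric])
    from h show "\<ominus>\<^bsub>?F\<^esub> h1 \<in> range const"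
      by (auto simp: minus const_def single_uminus[symmetric])
  qed (auto simp: free_algebra_def const_def intro!: image_eqI[of _ _ 1] simp flip: single_one)
  have inv: "\<exists>l. const l * k = 1 \<and> k * const l = 1"
    if k_in: "k \<in> range const" and k_nz: "k \<noteq> 0" for k :: "'a ncpoly"
  proof -
    obtain c where k: "k = const c"
      using k_in by blast
    moreover have "c \<noteq> 0"
      using k_nz unfolding k const_def by auto
    ultimately have "const (inverse c) * k = 1 \<and> k * const (inverse c) = 1"
      by (simp add: mul) (simp add: const_def)
    then show ?thesis by blast
  qed
  have "subfield (range const) ?F"
  proof (rule F.subfieldI)
    show "subcring (range const) ?F"
      using sr by (rule F.subcringI) (auto simp: free_algebra_def mul mult.commute)
    show "Units (?F \<lparr>carrier := range const\<rparr>) = range const - {\<zero>\<^bsub>?F\<^esub>}"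
      using inv by (fastforce simp: Units_def free_algebra_def)
  qed
  then show ?thesis
    unfolding scalars_def using ring_hom_ring.img_is_subfield(2)[OF hom] assms by blast
qed

definition homogeneous_component :: "'a ncpoly set \<Rightarrow> nat \<Rightarrow> 'a ncpoly set set" where
  "homogeneous_component S d = residue_class S ` homogeneous d"

text \<open>
  Complex dimensions in the quotient are taken over \<^term>\<open>scalars S\<close>, the image of the complex
  numbers.  This is a copy of the complex field unless the quotient is the zero ring, in which
  case the degree 0 component does not have dimension 1.
\<close>

datatype index = I1 | I2 | I3

definition polynomial_presentation :: "index ncpoly set \<Rightarrow> bool" where
  "polynomial_presentation S \<longleftrightarrow>
     (\<forall>d. ring.dimension (presented_algebra S) ((d + 2) choose 2)
            (scalars S) (homogeneous_component S d))"

definition commutator :: "'a::ring \<Rightarrow> 'a \<Rightarrow> 'a" where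
  "commutator x y = x * y - y * x"

definition relator :: "complex \<Rightarrow> complex \<Rightarrow> 'a \<Rightarrow> 'a \<Rightarrow> 'a ncpoly" where
  "relator q l i j =
     commutator (gen j) (gen i)
       - const ((q\<^sup>2 - 1) / (q\<^sup>2 + 1))
           * ((gen j)\<^sup>2 - (gen i)\<^sup>2 - const l * (gen i - gen j)\<^sup>2)"

definition A'_relators :: "complex \<Rightarrow> complex \<Rightarrow> complex \<Rightarrow> complex \<Rightarrow> index ncpoly set" where
  "A'_relators q l12 l13 l23 = {relator q l12 I1 I2, relator q l13 I1 I3, relator q l23 I2 I3}"

end

theory Submission
  imports Defs
begin

text \<open>
  Put \<open>Q = q\<^sup>2\<close>.  Each relation says that \<open>v\<^sub>j - v\<^sub>i\<close> skew-commutes, with factor \<open>Q\<close>, with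
  \<open>((1 + \<lambda>\<^sub>i\<^sub>j) v\<^sub>i + (1 - \<lambda>\<^sub>i\<^sub>j) v\<^sub>j) / 2\<close>.  The condition on the \<open>\<lambda>\<^sub>i\<^sub>j\<close> makes the discriminant of the
  symmetric part of the quadratic relation between \<open>v\<^sub>2 - v\<^sub>1\<close> and \<open>v\<^sub>3 - v\<^sub>2\<close> a nonzero square, so
  that relation splits into linear factors \<open>Y\<close>, \<open>Z\<close> and becomes \<open>Y Z = Q Z Y\<close>.  After correcting
  \<open>v\<^sub>2\<close> to a suitable \<open>X\<close>, the whole presentation becomes
  \<open>Y Z = Q Z Y\<close>, \<open>Z X = Q X Z\<close>, \<open>Y X = Q X Y + c Z\<^sup>2\<close>.
  The monomials \<open>X\<^sup>i Z\<^sup>k Y\<^sup>j\<close> then form a basis: they span by rewriting, and they are independent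
  because the three letters act on formal combinations of these monomials by the formulas that
  rewriting dictates.
\<close>

section \<open>Free algebras and presented algebras\<close>

lemma ncpoly_induct [case_names single add]:
  fixes p :: "'a ncpoly"
  assumes single: "\<And>w c. P (Poly_Mapping.single w c)"
    and add: "\<And>p r. P p \<Longrightarrow> P r \<Longrightarrow> P (p + r)"
  shows "P p"
proof (induction p rule: update_induct)
  case const
  show ?case using single[of 0 0] by simp
next
  case (update p a b)
  have "Poly_Mapping.update a b p = p + Poly_Mapping.single a b"
    using update.hyps
    by (intro poly_mapping_eqI)
      (auto simp: lookup_update lookup_add lookup_single when_def in_keys_iff)
  then show ?case using add[OF update.IH single] by simp
qed

lemma const_0 [simp]: "const 0 = 0"
  and const_1 [simp]: "const 1 = 1"
  and const_add: "const (a + b) = const a + const b"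
  and const_diff: "const (a - b) = const a - const b"
  and const_uminus: "const (- a) = - const a"
  and const_mult: "const (a * b) = const a * const b"
  by (simp_all add: const_def single_add single_diff single_uminus mult_single)

lemma const_commute: "p * const c = const c * p"
proof (induction p rule: ncpoly_induct)
  case (single w d)
  show ?case by (simp add: const_def mult_single mult.commute)
qed (simp add: algebra_simps)

lemma const_left_commute: "p * (const c * r) = const c * (p * r)"
  by (simp add: const_commute flip: mult.assoc)

lemma single_Word_Cons:
  "Poly_Mapping.single (Word (x # xs)) 1 = gen x * Poly_Mapping.single (Word xs) 1"
  by (simp add: gen_def mult_single plus_word_def)

lemma single_eq_const_mult:
  "Poly_Mapping.single w c = const c * Poly_Mapping.single w 1"
  by (simp add: const_def mult_single)

section \<open>Homogeneous noncommutative polynomials\<close>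

lemma homogeneous_0: "0 \<in> homogeneous d"
  by (simp add: homogeneous_def)

lemma homogeneous_add:
  "p \<in> homogeneous d \<Longrightarrow> r \<in> homogeneous d \<Longrightarrow> p + r \<in> homogeneous d"
  using Poly_Mapping.keys_add[of p r] by (auto simp: homogeneous_def)

lemma homogeneous_mult:
  "p \<in> homogeneous d \<Longrightarrow> r \<in> homogeneous d' \<Longrightarrow> p * r \<in> homogeneous (d + d')"
  using keys_mult[of p r] by (fastforce simp: homogeneous_def plus_word_def)

lemma homogeneous_const: "const c \<in> homogeneous 0"
  by (simp add: homogeneous_def const_def zero_word_def)

lemma homogeneous_const_mult: "p \<in> homogeneous d \<Longrightarrow> const c * p \<in> homogeneous d"
  using homogeneous_mult[OF homogeneous_const] by fastforce

lemma homogeneous_gen: "gen x \<in> homogeneous 1"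
  by (simp add: homogeneous_def gen_def)

lemma homogeneous_power: "p \<in> homogeneous 1 \<Longrightarrow> p ^ n \<in> homogeneous n"
proof (induction n)
  case 0
  show ?case using homogeneous_const[of 1] by simp
next
  case (Suc n)
  then show ?case using homogeneous_mult[of p 1 "p ^ n" n] by simp
qed

lemma homogeneous_sum:
  "(\<And>t. t \<in> T \<Longrightarrow> p t \<in> homogeneous d) \<Longrightarrow> sum p T \<in> homogeneous d"
  by (induction T rule: infinite_finite_induct) (simp_all add: homogeneous_0 homogeneous_add)

section \<open>Relation ideals and residue classes\<close>

lemma relation_ideal_0: "0 \<in> relation_ideal S"
  and relation_ideal_add:
    "p \<in> relation_ideal S \<Longrightarrow> r \<in> relation_ideal S \<Longrightarrow> p + r \<in> relation_ideal S"
  and relation_ideal_mult_left: "p \<in> relation_ideal S \<Longrightarrow> r * p \<in> relation_ideal S"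
  and relation_ideal_mult_right: "p \<in> relation_ideal S \<Longrightarrow> p * r \<in> relation_ideal S"
  and relation_ideal_base: "s \<in> S \<Longrightarrow> s \<in> relation_ideal S"
proof -
  interpret ideal "relation_ideal S" free_algebra by (rule ideal_relation_ideal)
  show "0 \<in> relation_ideal S"
    using additive_subgroup.zero_closed[OF is_additive_subgroup] by (simp add: free_algebra_def)
  show "p + r \<in> relation_ideal S" if "p \<in> relation_ideal S" "r \<in> relation_ideal S"
    using additive_subgroup.a_closed[OF is_additive_subgroup that] by (simp add: free_algebra_def)
  show "r * p \<in> relation_ideal S" if "p \<in> relation_ideal S"
    using I_l_closed[OF that, of r] by (simp add: free_algebra_def)
  show "p * r \<in> relation_ideal S" if "p \<in> relation_ideal S"
    using I_r_closed[OF that, of r] by (simp add: free_algebra_def)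
  show "s \<in> relation_ideal S" if "s \<in> S"
    using ring.genideal_self[OF ring_free_algebra, of S] that
    by (auto simp: relation_ideal_def free_algebra_def)
qed

lemma relation_ideal_diff:
  "p \<in> relation_ideal S \<Longrightarrow> r \<in> relation_ideal S \<Longrightarrow> p - r \<in> relation_ideal S"
  using relation_ideal_add[of p S "-1 * r"] relation_ideal_mult_left[of r S "-1"] by simp

text \<open>Closure under negation comes from multiplication by \<open>-1\<close>, so only zero,
  sums and products on both sides have to be checked.\<close>

lemma relation_ideal_minimal:
  fixes S I :: "'a ncpoly set"
  assumes "S \<subseteq> I" and "0 \<in> I" and "\<And>p r. p \<in> I \<Longrightarrow> r \<in> I \<Longrightarrow> p + r \<in> I"
    and "\<And>p r. p \<in> I \<Longrightarrow> r * p \<in> I" and "\<And>p r. p \<in> I \<Longrightarrow> p * r \<in> I"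
  shows "relation_ideal S \<subseteq> I"
proof -
  interpret R: ring "free_algebra :: 'a ncpoly ring" by (rule ring_free_algebra)
  have neg: "- p \<in> I" if "p \<in> I" for p
    using assms(4)[OF that, of "-1"] by simp
  have inv: "\<ominus>\<^bsub>free_algebra\<^esub> p = - p" for p :: "'a ncpoly"
    using R.minus_equality[of "- p" p] by (simp add: free_algebra_def)
  have "ideal I free_algebra"
  proof (rule idealI)
    show "subgroup I (add_monoid free_algebra)"
    proof (rule R.add.subgroupI)
      show "\<ominus>\<^bsub>free_algebra\<^esub> p \<in> I" if "p \<in> I" for p
        using neg[OF that] unfolding inv .
    qed (use assms in \<open>auto simp: free_algebra_def\<close>)
  qed (use assms in \<open>auto simp: free_algebra_def intro: ring_free_algebra[unfolded free_algebra_def]\<close>)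
  then show ?thesis
    unfolding relation_ideal_def by (rule R.genideal_minimal[OF _ assms(1)])
qed

lemma residue_class_eq_iff:
  "residue_class S p = residue_class S r \<longleftrightarrow> p - r \<in> relation_ideal S"
proof -
  have cl: "residue_class S p = {h + p |h. h \<in> relation_ideal S}" for p
    by (auto simp: residue_class_def a_r_coset_def' free_algebra_def)
  show ?thesis
  proof
    assume "residue_class S p = residue_class S r"
    moreover have "p \<in> residue_class S p"
      using relation_ideal_0[of S] by (force simp: cl)
    ultimately show "p - r \<in> relation_ideal S" by (auto simp: cl)
  next
    assume *: "p - r \<in> relation_ideal S"
    have "residue_class S p \<subseteq> residue_class S r" if "p - r \<in> relation_ideal S" for p r
    proof
      fix x assume "x \<in> residue_class S p"
      then obtain h where h: "h \<in> relation_ideal S" "x = h + p" by (auto simp: cl)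
      then have "x = (h + (p - r)) + r" by simp
      then show "x \<in> residue_class S r"
        using relation_ideal_add[OF h(1) that] unfolding cl by blast
    qed
    from this[OF *] this[of r p] show "residue_class S p = residue_class S r"
      using relation_ideal_diff[OF relation_ideal_0 *] by simp
  qed
qed

lemma residue_class_in_carrier: "residue_class S p \<in> carrier (presented_algebra S)"
  and residue_class_add:
    "residue_class S (p + r) = residue_class S p \<oplus>\<^bsub>presented_algebra S\<^esub> residue_class S r"
  and residue_class_mult:
    "residue_class S (p * r) = residue_class S p \<otimes>\<^bsub>presented_algebra S\<^esub> residue_class S r"
  and residue_class_0: "residue_class S 0 = \<zero>\<^bsub>presented_algebra S\<^esub>"
proof -
  have hom: "ring_hom_ring free_algebra (presented_algebra S) (residue_class S)"
    using ideal.rcos_ring_hom_ring[OF ideal_relation_ideal[of S]]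
    by (simp add: presented_algebra_def residue_class_def[abs_def])
  then interpret ring_hom_ring free_algebra "presented_algebra S" "residue_class S" .
  show "residue_class S p \<in> carrier (presented_algebra S)"
    using hom_closed[of p] by (simp add: free_algebra_def)
  show "residue_class S (p + r) = residue_class S p \<oplus>\<^bsub>presented_algebra S\<^esub> residue_class S r"
    using hom_add[of p r] by (simp add: free_algebra_def)
  show "residue_class S (p * r) = residue_class S p \<otimes>\<^bsub>presented_algebra S\<^esub> residue_class S r"
    using hom_mult[of p r] by (simp add: free_algebra_def)
  show "residue_class S 0 = \<zero>\<^bsub>presented_algebra S\<^esub>"
    using hom_zero by (simp add: free_algebra_def)
qed

section \<open>Linear combinations and dimension in the quotient\<close>

definition lin_comb :: "('t \<Rightarrow> 'a ncpoly) \<Rightarrow> 't set \<Rightarrow> ('t \<Rightarrow> complex) \<Rightarrow> 'a ncpoly" where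
  "lin_comb b T c = (\<Sum>t\<in>T. const (c t) * b t)"

text \<open>\<open>dimension\<close> is built up one vector at a time, so the proof inducts on
  \<open>T\<close>: independence modulo the ideal keeps the class of a new \<open>b u\<close>
  outside the span of the earlier classes, and the span grows by one line extension.\<close>

lemma dimension_residue_classes:
  assumes "finite T"
    and "\<And>c. lin_comb b T c \<in> relation_ideal S \<Longrightarrow> \<forall>t\<in>T. c t = 0"
  shows "ring.dimension (presented_algebra S) (card T) (scalars S)
           (residue_class S ` range (lin_comb b T))"
  using assms
proof (induction T)
  case empty
  interpret R: ring "presented_algebra S" by (rule ring_presented_algebra)
  show ?case using R.zero_dim by (simp add: lin_comb_def residue_class_0)
next
  case (insert u T)
  interpret R: ring "presented_algebra S" by (rule ring_presented_algebra)
  let ?E = "residue_class S ` range (lin_comb b T)"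
  have lin_comb_insert: "lin_comb b (insert u T) c = const (c u) * b u + lin_comb b T c" for c
    using insert.hyps by (simp add: lin_comb_def)
  have lin_comb_upd: "lin_comb b T (c(u := x)) = lin_comb b T c" for c x
    using insert.hyps unfolding lin_comb_def by (intro sum.cong) auto
  have "\<forall>t\<in>T. c t = 0" if "lin_comb b T c \<in> relation_ideal S" for c
  proof -
    have "\<forall>t\<in>insert u T. (c(u := 0)) t = 0"
      using that by (intro insert.prems) (simp only: lin_comb_insert lin_comb_upd, simp)
    with insert.hyps show ?thesis by (metis fun_upd_other insertCI)
  qed
  then have dim: "R.dimension (card T) (scalars S) ?E"
    by (rule insert.IH)
  have "residue_class S (b u) \<notin> ?E"
  proof
    assume "residue_class S (b u) \<in> ?E"
    then obtain c where "b u - lin_comb b T c \<in> relation_ideal S"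
      by (auto simp: residue_class_eq_iff)
    \<comment> \<open>Were \<open>b u\<close> congruent to a combination of the earlier elements,
      this combination, with coefficient 1 at \<open>u\<close>, would lie in the ideal.\<close>
    moreover have "lin_comb b (insert u T) ((\<lambda>t. - c t)(u := 1)) = b u - lin_comb b T c"
      by (simp add: lin_comb_insert lin_comb_upd) (simp add: lin_comb_def const_uminus sum_negf)
    ultimately show False
      using insert.prems[of "(\<lambda>t. - c t)(u := 1)"]
      by (metis fun_upd_same insertI1 zero_neq_one)
  qed
  then have "R.dimension (Suc (card T)) (scalars S)
      (R.line_extension (scalars S) (residue_class S (b u)) ?E)"
    using dim residue_class_in_carrier by (intro R.Suc_dim)
  moreover have "R.line_extension (scalars S) (residue_class S (b u)) ?E
      = residue_class S ` range (lin_comb b (insert u T))"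
  proof (intro equalityI subsetI)
    fix x assume "x \<in> R.line_extension (scalars S) (residue_class S (b u)) ?E"
    then obtain k c where "x = residue_class S (const k * b u + lin_comb b T c)"
      by (auto simp: R.line_extension_mem_iff scalars_def residue_class_add residue_class_mult)
    also have "const k * b u + lin_comb b T c = lin_comb b (insert u T) (c(u := k))"
      by (simp add: lin_comb_insert lin_comb_upd)
    finally show "x \<in> residue_class S ` range (lin_comb b (insert u T))" by blast
  next
    fix x assume "x \<in> residue_class S ` range (lin_comb b (insert u T))"
    then obtain c where "x = residue_class S (const (c u)) \<otimes>\<^bsub>presented_algebra S\<^esub>
        residue_class S (b u) \<oplus>\<^bsub>presented_algebra S\<^esub> residue_class S (lin_comb b T c)"
      by (auto simp: lin_comb_insert residue_class_add residue_class_mult)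
    then show "x \<in> R.line_extension (scalars S) (residue_class S (b u)) ?E"
      unfolding R.line_extension_mem_iff scalars_def by blast
  qed
  ultimately show ?case using insert.hyps by simp
qed

text \<open>The preimage of the span of the classes of the \<open>b t\<close>. It lets spanning
  arguments take place in the free algebra, where ordinary ring simplification applies.\<close>

definition reducible :: "'a ncpoly set \<Rightarrow> ('t \<Rightarrow> 'a ncpoly) \<Rightarrow> 't set \<Rightarrow> 'a ncpoly set" where
  "reducible S b T = {p. \<exists>c. p - lin_comb b T c \<in> relation_ideal S}"

lemma reducible_relation_ideal: "p \<in> relation_ideal S \<Longrightarrow> p \<in> reducible S b T"
  unfolding reducible_def by (auto simp: lin_comb_def intro!: exI[of _ "\<lambda>_. 0"])

lemma reducible_add:
  assumes "p \<in> reducible S b T" "r \<in> reducible S b T"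
  shows "p + r \<in> reducible S b T"
proof -
  obtain c c' where c: "p - lin_comb b T c \<in> relation_ideal S" "r - lin_comb b T c' \<in> relation_ideal S"
    using assms by (auto simp: reducible_def)
  have "p + r - lin_comb b T (\<lambda>t. c t + c' t) = (p - lin_comb b T c) + (r - lin_comb b T c')"
    by (simp add: lin_comb_def const_add algebra_simps sum.distrib)
  with relation_ideal_add[OF c] show ?thesis
    unfolding reducible_def mem_Collect_eq by metis
qed

lemma reducible_const_mult:
  assumes "p \<in> reducible S b T"
  shows "const k * p \<in> reducible S b T"
proof -
  obtain c where c: "p - lin_comb b T c \<in> relation_ideal S"
    using assms by (auto simp: reducible_def)
  have "const k * p - lin_comb b T (\<lambda>t. k * c t) = const k * (p - lin_comb b T c)"
    by (simp add: lin_comb_def const_mult algebra_simps sum_distrib_left)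
  with relation_ideal_mult_left[OF c] show ?thesis
    unfolding reducible_def mem_Collect_eq by metis
qed

lemma reducible_base:
  assumes "finite T" "t \<in> T"
  shows "b t \<in> reducible S b T"
proof -
  have "lin_comb b T (\<lambda>u. if u = t then 1 else 0) = (\<Sum>u\<in>T. if u = t then b u else 0)"
    unfolding lin_comb_def by (intro sum.cong) auto
  also have "\<dots> = b t" using assms by simp
  finally show ?thesis
    unfolding reducible_def using relation_ideal_0 by (auto intro!: exI[of _ "\<lambda>u. if u = t then 1 else 0"])
qed

lemma reducible_sum:
  "(\<And>t. t \<in> U \<Longrightarrow> p t \<in> reducible S b T) \<Longrightarrow> sum p U \<in> reducible S b T"
  by (induction U rule: infinite_finite_induct)
    (simp_all add: reducible_relation_ideal relation_ideal_0 reducible_add)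

lemma reducible_diff_relation_ideal:
  assumes "p - r \<in> relation_ideal S" "r \<in> reducible S b T"
  shows "p \<in> reducible S b T"
  using reducible_add[OF reducible_relation_ideal[OF assms(1)] assms(2)] by simp

section \<open>Actions of the free algebra\<close>

text \<open>The universal property of the free algebra: linear operators chosen for the letters
  extend to a representation. Vectors are arbitrary functions, so no finite support has to be
  tracked.\<close>

locale letter_action =
  fixes \<rho> :: "'a \<Rightarrow> ('t \<Rightarrow> complex) \<Rightarrow> 't \<Rightarrow> complex"
  assumes \<rho>_add: "\<rho> x (\<lambda>t. F t + G t) = (\<lambda>t. \<rho> x F t + \<rho> x G t)"
    and \<rho>_scale: "\<rho> x (\<lambda>t. k * F t) = (\<lambda>t. k * \<rho> x F t)"
begin

text \<open>With \<open>foldr\<close> the last letter acts first, so that products of words become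
  compositions of operators.\<close>

definition word_act :: "'a word \<Rightarrow> ('t \<Rightarrow> complex) \<Rightarrow> 't \<Rightarrow> complex" where
  "word_act w = foldr \<rho> (letters w)"

definition act :: "'a ncpoly \<Rightarrow> ('t \<Rightarrow> complex) \<Rightarrow> 't \<Rightarrow> complex" where
  "act p F = (\<lambda>t. \<Sum>w\<in>Poly_Mapping.keys p. Poly_Mapping.lookup p w * word_act w F t)"

lemma word_act_add: "word_act w (\<lambda>t. F t + G t) = (\<lambda>t. word_act w F t + word_act w G t)"
proof -
  have "foldr \<rho> xs (\<lambda>t. F t + G t) = (\<lambda>t. foldr \<rho> xs F t + foldr \<rho> xs G t)" for xs
    by (induction xs) (simp_all add: \<rho>_add)
  then show ?thesis by (simp add: word_act_def)
qed

lemma word_act_scale: "word_act w (\<lambda>t. k * F t) = (\<lambda>t. k * word_act w F t)"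
proof -
  have "foldr \<rho> xs (\<lambda>t. k * F t) = (\<lambda>t. k * foldr \<rho> xs F t)" for xs
    by (induction xs) (simp_all add: \<rho>_scale)
  then show ?thesis by (simp add: word_act_def)
qed

text \<open>Cancellation can shrink the keys of a sum, so additivity needs a common index set for
  all summands.\<close>

lemma act_superset:
  assumes "finite A" "Poly_Mapping.keys p \<subseteq> A"
  shows "act p F t = (\<Sum>w\<in>A. Poly_Mapping.lookup p w * word_act w F t)"
  unfolding act_def using assms by (intro sum.mono_neutral_left) (auto simp: in_keys_iff)

lemma act_single: "act (Poly_Mapping.single w c) F = (\<lambda>t. c * word_act w F t)"
  by (cases "c = 0") (simp_all add: act_def)

lemma act_plus: "act (p + r) F = (\<lambda>t. act p F t + act r F t)"
proof
  fix t
  let ?A = "Poly_Mapping.keys p \<union> Poly_Mapping.keys r"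
  have "Poly_Mapping.keys (p + r) \<subseteq> ?A" by (rule Poly_Mapping.keys_add)
  then show "act (p + r) F t = act p F t + act r F t"
    by (simp add: act_superset[of ?A] lookup_add algebra_simps sum.distrib)
qed

lemma act_fun_add: "act p (\<lambda>t. F t + G t) = (\<lambda>t. act p F t + act p G t)"
  by (simp add: act_def word_act_add algebra_simps sum.distrib)

lemma act_fun_scale: "act p (\<lambda>t. k * F t) = (\<lambda>t. k * act p F t)"
  by (simp add: act_def word_act_scale sum_distrib_left algebra_simps)

lemma act_mult: "act (p * r) F = act p (act r F)"
proof (induction p rule: ncpoly_induct)
  case (single w c)
  show ?case
  proof (induction r rule: ncpoly_induct)
    case (single u d)
    have "word_act (w + u) F = word_act w (word_act u F)"
      by (simp add: word_act_def plus_word_def)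
    then show ?case
      by (simp add: mult_single act_single word_act_scale mult.assoc)
  qed (simp add: distrib_left act_plus act_fun_add)
qed (simp add: distrib_right act_plus)

lemma act_0: "act 0 F = (\<lambda>_. 0)"
  by (simp add: act_def)

lemma act_1: "act 1 F = F"
  using act_single[of 0 1 F] by (simp add: word_act_def) (simp add: zero_word_def)

lemma act_gen: "act (gen x) F = \<rho> x F"
  by (simp add: gen_def act_single word_act_def)

lemma act_const: "act (const c) F = (\<lambda>t. c * F t)"
  by (simp add: const_def act_single word_act_def) (simp add: zero_word_def)

lemma act_const_mult: "act (const c * p) F = (\<lambda>t. c * act p F t)"
  by (simp add: act_mult act_const)

lemma act_diff: "act (p - r) F = (\<lambda>t. act p F t - act r F t)"
  using act_plus[of p "const (-1) * r" F]
  by (simp only: act_const_mult) (simp add: const_uminus)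

lemma act_fun_0: "act p (\<lambda>_. 0) = (\<lambda>_. 0)"
  using act_fun_scale[of p 0] by simp

lemma act_sum: "act (sum p U) F = (\<lambda>t. \<Sum>u\<in>U. act (p u) F t)"
  by (induction U rule: infinite_finite_induct) (simp_all add: act_0 act_plus)

lemma act_power: "act (p ^ n) F = (act p ^^ n) F"
  by (induction n) (simp_all add: act_1 act_mult)

text \<open>The annihilator of a representation is a two-sided ideal. All vectors \<open>F\<close>
  are quantified because \<open>p * r\<close> applies \<open>p\<close> to the vector
  \<open>act r F\<close>.\<close>

lemma act_relation_ideal:
  assumes "p \<in> relation_ideal S" and "\<And>s F. s \<in> S \<Longrightarrow> act s F = (\<lambda>_. 0)"
  shows "act p F = (\<lambda>_. 0)"
proof -
  have "relation_ideal S \<subseteq> {p. \<forall>F. act p F = (\<lambda>_. 0)}"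
    by (rule relation_ideal_minimal)
      (auto simp: assms(2) act_0 act_plus act_mult act_fun_0)
  with assms(1) show ?thesis by auto
qed

end

section \<open>The monomial basis\<close>

lemma const_const_mult: "const a * (const b * p) = const (a * b) * p"
  by (simp add: const_mult mult.assoc)

lemma sum_single:
  "(\<Sum>w\<in>Poly_Mapping.keys p. Poly_Mapping.single w (Poly_Mapping.lookup p w)) = p"
  by (rule poly_mapping_eqI)
    (auto simp: lookup_sum lookup_single when_def in_keys_iff sum.delta)

definition linear_form :: "(index \<Rightarrow> complex) \<Rightarrow> index ncpoly" where
  "linear_form u = (\<Sum>a\<in>{I1, I2, I3}. const (u a) * gen a)"

text \<open>Triples are ordered as the exponents of \<open>X\<close>, \<open>Z\<close>, \<open>Y\<close>: with this order, moving a letter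
  into place only ever multiplies by powers of \<open>Q\<close>, so \<open>Q\<close> need not be invertible.\<close>

definition skew_monomial :: "'a ncpoly \<Rightarrow> 'a ncpoly \<Rightarrow> 'a ncpoly \<Rightarrow> nat \<times> nat \<times> nat \<Rightarrow> 'a ncpoly" where
  "skew_monomial X Z Y = (\<lambda>(i, k, j). X ^ i * Z ^ k * Y ^ j)"

definition exponents :: "nat \<Rightarrow> (nat \<times> nat \<times> nat) set" where
  "exponents d = {(i, k, j). i + k + j = d}"

lemma exponentsE:
  assumes "t \<in> exponents d"
  obtains i k j where "t = (i, k, j)" "i + k + j = d"
  using assms by (auto simp: exponents_def)

text \<open>A triple is determined by \<open>n = i + k\<close> and \<open>i\<close>; counting then
  reduces to summing \<open>n + 1\<close> over \<open>n \<le> d\<close>.\<close>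

lemma exponents_Sigma:
  "exponents d = (\<lambda>(n, i). (i, n - i, d - n)) ` (SIGMA n:{..d}. {..n})"
proof (intro equalityI subsetI)
  fix t assume "t \<in> exponents d"
  then obtain i k j where "t = (i, k, j)" "i + k + j = d" by (rule exponentsE)
  then show "t \<in> (\<lambda>(n, i). (i, n - i, d - n)) ` (SIGMA n:{..d}. {..n})"
    by (intro image_eqI[of _ _ "(i + k, i)"]) auto
qed (auto simp: exponents_def)

lemma finite_exponents [simp]: "finite (exponents d)"
  by (simp add: exponents_Sigma)

lemma card_exponents: "card (exponents d) = (d + 2) choose 2"
proof -
  have "inj_on (\<lambda>(n, i). (i, n - i, d - n)) (SIGMA n:{..d}. {..n})"
    by (auto simp: inj_on_def)
  then have "card (exponents d) = card (SIGMA n:{..d}. {..n})"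
    unfolding exponents_Sigma by (rule card_image)
  also have "\<dots> = (\<Sum>n\<le>d. Suc n)" by simp
  also have "\<dots> = (d + 2) choose 2"
    by (induction d) (simp_all add: numeral_2_eq_2)
  finally show ?thesis .
qed

text \<open>The coefficients in \<open>Y X\<^sup>i = Q\<^sup>i X\<^sup>i Y + c (straightening_coeff Q i) X\<^sup>i\<^sup>-\<^sup>1 Z\<^sup>2\<close>.\<close>

fun straightening_coeff :: "complex \<Rightarrow> nat \<Rightarrow> complex" where
  "straightening_coeff Q 0 = 0"
| "straightening_coeff Q (Suc i) = Q * straightening_coeff Q i + Q ^ i * Q ^ i"

text \<open>A linear change of generators that brings the relations to skew form.
  \<open>P_in\<close> and \<open>gen_comb\<close> serve spanning; \<open>S_comb\<close> and
  \<open>dual\<close> serve independence. \<open>gen_comb\<close> and \<open>dual\<close> are the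
  two halves of the invertibility of the coordinate change.\<close>

locale skew_presentation =
  fixes S :: "index ncpoly set" and x y z x' y' z' :: "index \<Rightarrow> complex" and Q c :: complex
    and X Y Z :: "index ncpoly" and P1 P2 P3 :: "index ncpoly"
  assumes X_def: "X = linear_form x" and Y_def: "Y = linear_form y" and Z_def: "Z = linear_form z"
    and P1_def: "P1 = Y * Z - const Q * (Z * Y)"
    and P2_def: "P2 = Z * X - const Q * (X * Z)"
    and P3_def: "P3 = Y * X - const Q * (X * Y) - const c * (Z * Z)"
    and P_in: "P1 \<in> relation_ideal S" "P2 \<in> relation_ideal S" "P3 \<in> relation_ideal S"
    and S_comb: "\<And>s. s \<in> S \<Longrightarrow> \<exists>k1 k2 k3. s = const k1 * P1 + const k2 * P2 + const k3 * P3"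
    and gen_comb: "\<And>a. gen a = const (x' a) * X + const (y' a) * Y + const (z' a) * Z"
    and dual: "(\<Sum>a\<in>{I1, I2, I3}. x a * x' a) = 1" "(\<Sum>a\<in>{I1, I2, I3}. x a * y' a) = 0"
      "(\<Sum>a\<in>{I1, I2, I3}. x a * z' a) = 0"
      "(\<Sum>a\<in>{I1, I2, I3}. y a * x' a) = 0" "(\<Sum>a\<in>{I1, I2, I3}. y a * y' a) = 1"
      "(\<Sum>a\<in>{I1, I2, I3}. y a * z' a) = 0"
      "(\<Sum>a\<in>{I1, I2, I3}. z a * x' a) = 0" "(\<Sum>a\<in>{I1, I2, I3}. z a * y' a) = 0"
      "(\<Sum>a\<in>{I1, I2, I3}. z a * z' a) = 1"
begin

section \<open>Straightening and spanning\<close>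

lemma ZX_power: "Z * X ^ i - const (Q ^ i) * (X ^ i * Z) \<in> relation_ideal S"
proof (induction i)
  case 0
  show ?case by (simp add: relation_ideal_0)
next
  case (Suc i)
  have "Z * X ^ Suc i - const (Q ^ Suc i) * (X ^ Suc i * Z)
      = P2 * X ^ i + const Q * X * (Z * X ^ i - const (Q ^ i) * (X ^ i * Z))"
    unfolding P2_def
    by (simp add: algebra_simps const_left_commute[of X] const_const_mult)
  then show ?case
    using relation_ideal_add[OF relation_ideal_mult_right[OF P_in(2)]
        relation_ideal_mult_left[OF Suc]] by simp
qed

lemma YZ_power: "Y * Z ^ k - const (Q ^ k) * (Z ^ k * Y) \<in> relation_ideal S"
proof (induction k)
  case 0
  show ?case by (simp add: relation_ideal_0)
next
  case (Suc k)
  have "Y * Z ^ Suc k - const (Q ^ Suc k) * (Z ^ Suc k * Y)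
      = P1 * Z ^ k + const Q * Z * (Y * Z ^ k - const (Q ^ k) * (Z ^ k * Y))"
    unfolding P1_def
    by (simp add: algebra_simps const_left_commute[of Z] const_const_mult)
  then show ?case
    using relation_ideal_add[OF relation_ideal_mult_right[OF P_in(1)]
        relation_ideal_mult_left[OF Suc]] by simp
qed

lemma ZZX_power: "Z * Z * X ^ i - const (Q ^ i * Q ^ i) * (X ^ i * (Z * Z)) \<in> relation_ideal S"
proof -
  let ?r = "Z * X ^ i - const (Q ^ i) * (X ^ i * Z)"
  have "Z * Z * X ^ i - const (Q ^ i * Q ^ i) * (X ^ i * (Z * Z))
      = Z * ?r + const (Q ^ i) * (?r * Z)"
    by (simp add: algebra_simps const_left_commute[of Z] const_const_mult)
  then show ?thesis
    by (simp add: ZX_power relation_ideal_add relation_ideal_mult_left relation_ideal_mult_right)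
qed

text \<open>Passing the first \<open>X\<close> creates \<open>c * Z * Z\<close>, which then crosses
  the remaining \<open>X ^ i\<close> with factor \<open>Q ^ i * Q ^ i\<close>. This is the recursion
  of \<open>straightening_coeff\<close>.\<close>

lemma YX_power:
  "Y * X ^ i - const (Q ^ i) * (X ^ i * Y)
     - const (c * straightening_coeff Q i) * (X ^ (i - 1) * (Z * Z)) \<in> relation_ideal S"
  (is "?r i \<in> _")
proof (induction i)
  case 0
  show ?case by (simp add: relation_ideal_0)
next
  case (Suc i)
  \<comment> \<open>For \<open>i = 0\<close> the exponent \<open>i - 1\<close> is truncated, but the
    coefficient \<open>straightening_coeff Q 0\<close> is zero.\<close>
  have Xd: "X * (const (c * straightening_coeff Q i) * (X ^ (i - 1) * (Z * Z)))
      = const (c * straightening_coeff Q i) * (X ^ i * (Z * Z))"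
    by (cases i) (simp_all add: const_left_commute[of X] mult.assoc)
  have "?r (Suc i) = P3 * X ^ i + const Q * (X * ?r i)
      + const c * (Z * Z * X ^ i - const (Q ^ i * Q ^ i) * (X ^ i * (Z * Z)))"
    unfolding P3_def right_diff_distrib[of X] Xd
    by (simp add: algebra_simps const_left_commute[of X] const_const_mult const_add)
  then show ?case
    by (simp only:) (intro relation_ideal_add relation_ideal_mult_left
        relation_ideal_mult_right[OF P_in(3)] Suc ZZX_power)
qed

abbreviation "B \<equiv> skew_monomial X Z Y"

lemma B_reducible: "i + k + j = d \<Longrightarrow> X ^ i * (Z ^ k * Y ^ j) \<in> reducible S B (exponents d)"
  using reducible_base[OF finite_exponents, of "(i, k, j)" d B S]
  by (simp add: skew_monomial_def exponents_def mult.assoc)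

lemma X_B: "X * B t \<in> reducible S B (exponents (Suc d))" if t_in: "t \<in> exponents d"
proof -
  obtain i k j where t: "t = (i, k, j)" "i + k + j = d"
    using t_in by (rule exponentsE)
  then show ?thesis
    using B_reducible[of "Suc i" k j "Suc d"] by (simp add: skew_monomial_def mult.assoc)
qed

lemma Z_B: "Z * B t \<in> reducible S B (exponents (Suc d))" if t_in: "t \<in> exponents d"
proof -
  obtain i k j where t: "t = (i, k, j)" "i + k + j = d"
    using t_in by (rule exponentsE)
  show ?thesis
  proof (rule reducible_diff_relation_ideal)
    have "Z * B t - const (Q ^ i) * (X ^ i * (Z ^ Suc k * Y ^ j))
        = (Z * X ^ i - const (Q ^ i) * (X ^ i * Z)) * (Z ^ k * Y ^ j)"
      by (simp add: t skew_monomial_def algebra_simps)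
    then show "Z * B t - const (Q ^ i) * (X ^ i * (Z ^ Suc k * Y ^ j)) \<in> relation_ideal S"
      by (simp only: relation_ideal_mult_right[OF ZX_power])
    show "const (Q ^ i) * (X ^ i * (Z ^ Suc k * Y ^ j)) \<in> reducible S B (exponents (Suc d))"
      using t by (intro reducible_const_mult B_reducible) simp
  qed
qed

text \<open>\<open>Y\<close> first crosses \<open>X ^ i\<close> and then \<open>Z ^ k\<close>. The
  correction term is already in normal order, its \<open>Z * Z\<close> merging with
  \<open>Z ^ k\<close>.\<close>

lemma Y_B: "Y * B t \<in> reducible S B (exponents (Suc d))" if t_in: "t \<in> exponents d"
proof -
  obtain i k j where t: "t = (i, k, j)" "i + k + j = d"
    using t_in by (rule exponentsE)
  let ?u = "const (Q ^ i * Q ^ k) * (X ^ i * (Z ^ k * Y ^ Suc j))"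
  let ?v = "const (c * straightening_coeff Q i) * (X ^ (i - 1) * (Z ^ Suc (Suc k) * Y ^ j))"
  show ?thesis
  proof (rule reducible_diff_relation_ideal)
    have "Y * B t - (?u + ?v)
        = (Y * X ^ i - const (Q ^ i) * (X ^ i * Y)
            - const (c * straightening_coeff Q i) * (X ^ (i - 1) * (Z * Z))) * (Z ^ k * Y ^ j)
          + const (Q ^ i) * (X ^ i * ((Y * Z ^ k - const (Q ^ k) * (Z ^ k * Y)) * Y ^ j))"
      by (simp add: t skew_monomial_def algebra_simps const_left_commute[of "X ^ i"] const_const_mult)
    then show "Y * B t - (?u + ?v) \<in> relation_ideal S"
      by (simp only:) (intro relation_ideal_add relation_ideal_mult_left
          relation_ideal_mult_right YX_power YZ_power)
    have "?v \<in> reducible S B (exponents (Suc d))"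
    proof (cases i)
      case 0
      then show ?thesis by (simp add: reducible_relation_ideal relation_ideal_0)
    next
      case (Suc i')
      then show ?thesis using t by (intro reducible_const_mult B_reducible) simp
    qed
    moreover have "?u \<in> reducible S B (exponents (Suc d))"
      using t by (intro reducible_const_mult B_reducible) simp
    ultimately show "?u + ?v \<in> reducible S B (exponents (Suc d))"
      by (intro reducible_add)
  qed
qed

lemma mult_reducible:
  assumes "\<And>t. t \<in> exponents d \<Longrightarrow> w * B t \<in> reducible S B (exponents (Suc d))"
    and "p \<in> reducible S B (exponents d)"
  shows "w * p \<in> reducible S B (exponents (Suc d))"
proof -
  obtain h where h: "p - lin_comb B (exponents d) h \<in> relation_ideal S"
    using assms(2) by (auto simp: reducible_def)
  have eq: "w * lin_comb B (exponents d) h = (\<Sum>t\<in>exponents d. const (h t) * (w * B t))"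
    by (simp add: lin_comb_def sum_distrib_left const_left_commute)
  show ?thesis
  proof (rule reducible_diff_relation_ideal)
    show "w * p - w * lin_comb B (exponents d) h \<in> relation_ideal S"
      using relation_ideal_mult_left[OF h, of w] by (simp add: right_diff_distrib)
    show "w * lin_comb B (exponents d) h \<in> reducible S B (exponents (Suc d))"
      unfolding eq by (intro reducible_sum reducible_const_mult assms(1))
  qed
qed

lemma gen_mult_reducible:
  assumes "p \<in> reducible S B (exponents d)"
  shows "gen a * p \<in> reducible S B (exponents (Suc d))"
proof -
  have "gen a * p = const (x' a) * (X * p) + const (y' a) * (Y * p) + const (z' a) * (Z * p)"
    by (subst gen_comb) (simp add: distrib_right mult.assoc)
  then show ?thesis
    using assms by (simp add: reducible_add reducible_const_mult mult_reducible X_B Y_B Z_B)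
qed

text \<open>A word is built by prefixing letters, and each letter, a combination of
  \<open>X\<close>, \<open>Y\<close>, \<open>Z\<close>, carries combinations of monomials of one
  degree into the next.\<close>

lemma homogeneous_reducible:
  assumes "p \<in> homogeneous d"
  shows "p \<in> reducible S B (exponents d)"
proof -
  have word: "Poly_Mapping.single (Word xs) 1 \<in> reducible S B (exponents (length xs))" for xs
  proof (induction xs)
    case Nil
    show ?case using B_reducible[of 0 0 0 0] by (simp flip: zero_word_def)
  next
    case (Cons a xs)
    then show ?case by (simp add: single_Word_Cons gen_mult_reducible)
  qed
  have "p = (\<Sum>w\<in>Poly_Mapping.keys p. Poly_Mapping.single w (Poly_Mapping.lookup p w))"
    by (rule sum_single[symmetric])
  moreover have "Poly_Mapping.single w (Poly_Mapping.lookup p w) \<in> reducible S B (exponents d)"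
    if "w \<in> Poly_Mapping.keys p" for w
    using word[of "letters w"] assms that
    by (subst single_eq_const_mult) (auto simp: homogeneous_def intro: reducible_const_mult)
  ultimately show ?thesis using reducible_sum by metis
qed

text \<open>Left multiplication by \<open>X\<close>, \<open>Z\<close>, \<open>Y\<close> on formal series in the monomials
  \<open>X\<^sup>i Z\<^sup>k Y\<^sup>j\<close>, read off from the straightening relations.\<close>

definition opX :: "(nat \<times> nat \<times> nat \<Rightarrow> complex) \<Rightarrow> nat \<times> nat \<times> nat \<Rightarrow> complex" where
  "opX F = (\<lambda>(i, k, j). if i = 0 then 0 else F (i - 1, k, j))"

definition opZ :: "(nat \<times> nat \<times> nat \<Rightarrow> complex) \<Rightarrow> nat \<times> nat \<times> nat \<Rightarrow> complex" where
  "opZ F = (\<lambda>(i, k, j). if k = 0 then 0 else Q ^ i * F (i, k - 1, j))"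

definition opY :: "(nat \<times> nat \<times> nat \<Rightarrow> complex) \<Rightarrow> nat \<times> nat \<times> nat \<Rightarrow> complex" where
  "opY F = (\<lambda>(i, k, j). (if j = 0 then 0 else Q ^ (i + k) * F (i, k, j - 1))
     + (if k < 2 then 0 else c * straightening_coeff Q (Suc i) * F (Suc i, k - 2, j)))"

text \<open>Forced by \<open>gen_comb\<close>: the operator of a letter is the matching combination
  of the operators of \<open>X\<close>, \<open>Y\<close>, \<open>Z\<close>.\<close>

definition letter_op :: "index \<Rightarrow> (nat \<times> nat \<times> nat \<Rightarrow> complex) \<Rightarrow> nat \<times> nat \<times> nat \<Rightarrow> complex"
  where "letter_op a F = (\<lambda>t. x' a * opX F t + y' a * opY F t + z' a * opZ F t)"

text \<open>The operators act on coefficient functions, so the value at a triple collects the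
  monomials sent to it; hence \<open>opY\<close> reads \<open>F\<close> at
  \<open>(Suc i, k - 2, j)\<close>. The guards exclude truncated subtraction.\<close>

lemma op_apply:
  "opX F (i, k, j) = (if i = 0 then 0 else F (i - 1, k, j))"
  "opZ F (i, k, j) = (if k = 0 then 0 else Q ^ i * F (i, k - 1, j))"
  "opY F (i, k, j) = (if j = 0 then 0 else Q ^ (i + k) * F (i, k, j - 1))
     + (if k < 2 then 0 else c * straightening_coeff Q (Suc i) * F (Suc i, k - 2, j))"
  by (simp_all add: opX_def opY_def opZ_def)

sublocale letter_action letter_op
  by standard
    (auto simp: letter_op_def op_apply fun_eq_iff algebra_simps)

lemma act_linear_form:
  "act (linear_form u) F = (\<lambda>t. (\<Sum>a\<in>{I1, I2, I3}. u a * x' a) * opX F t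
     + (\<Sum>a\<in>{I1, I2, I3}. u a * y' a) * opY F t + (\<Sum>a\<in>{I1, I2, I3}. u a * z' a) * opZ F t)"
  by (simp add: linear_form_def act_plus act_const_mult act_gen letter_op_def algebra_simps)

lemma act_X: "act X F = opX F" and act_Y: "act Y F = opY F" and act_Z: "act Z F = opZ F"
  unfolding X_def Y_def Z_def act_linear_form dual by simp_all

text \<open>This reflects the consistency of the rewriting: both ways of straightening
  \<open>Y * Z * X\<close> give the same result. The main and the correction term of
  \<open>opY\<close> each pick up one factor \<open>Q\<close>.\<close>

lemma act_P1: "act P1 F = (\<lambda>_. 0)"
  unfolding P1_def
  by (auto simp: act_diff act_const act_mult act_X act_Y act_Z op_apply
      fun_eq_iff numeral_2_eq_2 power_add algebra_simps less_Suc_eq diff_Suc split: nat.splits)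

lemma act_P2: "act P2 F = (\<lambda>_. 0)"
  unfolding P2_def
  by (auto simp: act_diff act_const act_mult act_X act_Y act_Z op_apply
      fun_eq_iff power_add algebra_simps diff_Suc split: nat.splits)

text \<open>The coefficient of \<open>F (i, k - 2, j)\<close> cancels by the recursion of
  \<open>straightening_coeff\<close>; at \<open>i = 0\<close> its initial value zero is
  used.\<close>

lemma act_P3: "act P3 F = (\<lambda>_. 0)"
  unfolding P3_def
  by (auto simp: act_diff act_plus act_const act_mult act_X act_Y act_Z op_apply
      fun_eq_iff numeral_2_eq_2 power_add algebra_simps less_Suc_eq diff_Suc split: nat.splits)

lemma act_S: "s \<in> S \<Longrightarrow> act s F = (\<lambda>_. 0)"
  using S_comb[of s] by (auto simp: act_plus act_const_mult act_P1 act_P2 act_P3)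

section \<open>Linear independence and dimensions\<close>

definition delta :: "nat \<times> nat \<times> nat \<Rightarrow> nat \<times> nat \<times> nat \<Rightarrow> complex" where
  "delta t = (\<lambda>u. if u = t then 1 else 0)"

text \<open>\<open>delta (0, 0, 0)\<close> plays the role of 1. Applying \<open>Y\<close>, then
  \<open>Z\<close>, then \<open>X\<close> only prefixes letters in normal order, so neither powers
  of \<open>Q\<close> nor corrections appear.\<close>

lemma act_B: "act (B t) (delta (0, 0, 0)) = delta t"
proof -
  obtain i k j where t: "t = (i, k, j)" by (cases t)
  have "(opY ^^ j) (delta (0, 0, 0)) = delta (0, 0, j)"
    by (induction j) (auto simp: op_apply delta_def fun_eq_iff)
  moreover have "(opZ ^^ k) (delta (0, 0, j)) = delta (0, k, j)"
    by (induction k) (auto simp: op_apply delta_def fun_eq_iff)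
  moreover have "(opX ^^ i) (delta (0, k, j)) = delta (i, k, j)"
    by (induction i) (auto simp: op_apply delta_def fun_eq_iff)
  moreover have "act X = opX" "act Y = opY" "act Z = opZ"
    by (simp_all add: fun_eq_iff act_X act_Y act_Z)
  ultimately show ?thesis by (simp add: t skew_monomial_def act_mult act_power)
qed

text \<open>Acting on \<open>delta (0, 0, 0)\<close> reads off the coefficients, while elements of
  the ideal act as zero.\<close>

lemma B_independent:
  assumes "finite T" and "lin_comb B T h \<in> relation_ideal S"
  shows "\<forall>t\<in>T. h t = 0"
proof
  fix t assume t: "t \<in> T"
  have "0 = act (lin_comb B T h) (delta (0, 0, 0)) t"
    by (subst act_relation_ideal[OF assms(2) act_S]) simp_all
  also have "\<dots> = (\<Sum>u\<in>T. if t = u then h u else 0)"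
    by (simp add: lin_comb_def act_sum act_const_mult act_B)
      (simp add: delta_def if_distrib cong: if_cong)
  also have "\<dots> = h t" using assms(1) t by simp
  finally show "h t = 0" by simp
qed

lemma homogeneous_linear_form: "linear_form u \<in> homogeneous 1"
  unfolding linear_form_def
  by (intro homogeneous_sum homogeneous_const_mult homogeneous_gen)

lemma homogeneous_comb: "lin_comb B (exponents d) h \<in> homogeneous d"
proof -
  have "B t \<in> homogeneous d" if t_in: "t \<in> exponents d" for t
  proof -
    obtain i k j where t: "t = (i, k, j)" "i + k + j = d"
      using t_in by (rule exponentsE)
    show ?thesis
      unfolding t(1) t(2)[symmetric] skew_monomial_def prod.case X_def Y_def Z_def
      by (intro homogeneous_mult homogeneous_power homogeneous_linear_form)
  qed
  then show ?thesis
    unfolding lin_comb_def by (intro homogeneous_sum homogeneous_const_mult)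
qed

text \<open>Reducibility and homogeneity of the monomials identify each component with the span of
  the monomials of that degree; independence makes its dimension their number.\<close>

lemma skew_polynomial_presentation: "polynomial_presentation S"
  unfolding polynomial_presentation_def
proof
  fix d
  have "homogeneous_component S d = residue_class S ` range (lin_comb B (exponents d))"
  proof (intro equalityI subsetI)
    fix r assume "r \<in> homogeneous_component S d"
    then obtain p where p: "p \<in> homogeneous d" "r = residue_class S p"
      by (auto simp: homogeneous_component_def)
    then show "r \<in> residue_class S ` range (lin_comb B (exponents d))"
      using homogeneous_reducible[of p d] by (auto simp: reducible_def residue_class_eq_iff)
  qed (use homogeneous_comb in \<open>auto simp: homogeneous_component_def\<close>)
  then show "ring.dimension (presented_algebra S) ((d + 2) choose 2) (scalars S)
      (homogeneous_component S d)"
    using dimension_residue_classes[of "exponents d" B S] B_independent[of "exponents d"]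
    by (simp add: card_exponents)
qed

end

section \<open>Adapted coordinates\<close>

text \<open>Quadratic noncommutative polynomials as 3 by 3 matrices, so that an identity between
  them becomes nine scalar identities.\<close>

definition bilinear_form :: "(index \<Rightarrow> index \<Rightarrow> complex) \<Rightarrow> index ncpoly" where
  "bilinear_form m = (\<Sum>a\<in>{I1, I2, I3}. \<Sum>b\<in>{I1, I2, I3}. const (m a b) * (gen a * gen b))"

lemma linear_form_eqI:
  assumes "u I1 = v I1" "u I2 = v I2" "u I3 = v I3"
  shows "linear_form u = linear_form v"
  using assms by (simp add: linear_form_def)

lemma bilinear_form_eqI:
  assumes "m I1 I1 = m' I1 I1" "m I1 I2 = m' I1 I2" "m I1 I3 = m' I1 I3"
    and "m I2 I1 = m' I2 I1" "m I2 I2 = m' I2 I2" "m I2 I3 = m' I2 I3"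
    and "m I3 I1 = m' I3 I1" "m I3 I2 = m' I3 I2" "m I3 I3 = m' I3 I3"
  shows "bilinear_form m = bilinear_form m'"
  using assms by (simp add: bilinear_form_def)

lemma linear_form_mult:
  "linear_form u * linear_form v = bilinear_form (\<lambda>a b. u a * v b)"
  by (simp add: linear_form_def bilinear_form_def algebra_simps const_left_commute[of "gen _"]
      const_const_mult)

lemma bilinear_form_add: "bilinear_form m + bilinear_form m' = bilinear_form (\<lambda>a b. m a b + m' a b)"
  and bilinear_form_diff: "bilinear_form m - bilinear_form m' = bilinear_form (\<lambda>a b. m a b - m' a b)"
  and bilinear_form_const: "const h * bilinear_form m = bilinear_form (\<lambda>a b. h * m a b)"
  by (simp_all add: bilinear_form_def const_add const_diff algebra_simps const_const_mult)

lemma linear_form_add: "linear_form u + linear_form v = linear_form (\<lambda>a. u a + v a)"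
  and linear_form_diff: "linear_form u - linear_form v = linear_form (\<lambda>a. u a - v a)"
  and linear_form_const: "const h * linear_form u = linear_form (\<lambda>a. h * u a)"
  by (simp_all add: linear_form_def const_add const_diff algebra_simps const_const_mult)

lemmas form_simps = linear_form_mult bilinear_form_add bilinear_form_diff bilinear_form_const
  linear_form_add linear_form_diff linear_form_const

definition unit_coeffs :: "index \<Rightarrow> index \<Rightarrow> complex" where
  "unit_coeffs i = (\<lambda>a. if a = i then 1 else 0)"

lemma unit_coeffs_simps:
  "unit_coeffs I1 I1 = 1" "unit_coeffs I1 I2 = 0" "unit_coeffs I1 I3 = 0"
  "unit_coeffs I2 I1 = 0" "unit_coeffs I2 I2 = 1" "unit_coeffs I2 I3 = 0"
  "unit_coeffs I3 I1 = 0" "unit_coeffs I3 I2 = 0" "unit_coeffs I3 I3 = 1"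
  by (simp_all add: unit_coeffs_def)

lemma gen_eq_linear_form: "gen i = linear_form (unit_coeffs i)"
  by (cases i) (simp_all add: linear_form_def unit_coeffs_def)

section \<open>The relations as skew commutations\<close>

definition skew_relator :: "complex \<Rightarrow> complex \<Rightarrow> index \<Rightarrow> index \<Rightarrow> index ncpoly" where
  "skew_relator Q s i j =
     (let u = linear_form (\<lambda>a. unit_coeffs j a - unit_coeffs i a);
          w = linear_form (\<lambda>a. s * unit_coeffs i a + (1 - s) * unit_coeffs j a)
      in u * w - const Q * (w * u))"

lemma relator_eq_skew_relator:
  assumes "q\<^sup>2 + 1 \<noteq> 0"
  shows "relator q (2 * s - 1) i j = const (2 / (q\<^sup>2 + 1)) * skew_relator (q\<^sup>2) s i j"
proof -
  \<comment> \<open>Both equations for \<open>h\<close> are free of division, which reduces the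
    claim to a polynomial identity.\<close>
  define h where "h = 2 / (q\<^sup>2 + 1)"
  have h: "h * q\<^sup>2 = 2 - h" "(q\<^sup>2 - 1) / (q\<^sup>2 + 1) = 1 - h"
    using assms by (simp_all add: h_def field_simps)
  \<comment> \<open>The matrix entries: \<open>a\<close>, \<open>a'\<close> are the coefficients of
    the generators \<open>i\<close>, \<open>j\<close> in the left factor, \<open>b\<close>,
    \<open>b'\<close> those in the right factor.\<close>
  have "a' * b - a * b' - (1 - h) * (a' * b' - a * b - (2 * s - 1) * ((a - a') * (b - b')))
      = h * ((a' - a) * (s * b + (1 - s) * b')
          - q\<^sup>2 * ((s * a + (1 - s) * a') * (b' - b)))" for a a' b b'
    using h(1) by Groebner_Basis.algebra
  then show ?thesis
    unfolding relator_def commutator_def skew_relator_def Let_def gen_eq_linear_form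
      power2_eq_square[of "linear_form _"] power2_eq_square[of "linear_form _ - linear_form _"]
      form_simps h(2) h_def[symmetric]
    by (intro arg_cong[of _ _ bilinear_form] ext)
qed

definition form_coeffs :: "complex \<Rightarrow> complex \<Rightarrow> complex \<Rightarrow> index \<Rightarrow> complex" where
  "form_coeffs u1 u2 u3 = (\<lambda>a. case a of I1 \<Rightarrow> u1 | I2 \<Rightarrow> u2 | I3 \<Rightarrow> u3)"

lemma form_coeffs_simps [simp]:
  "form_coeffs u1 u2 u3 I1 = u1" "form_coeffs u1 u2 u3 I2 = u2" "form_coeffs u1 u2 u3 I3 = u3"
  by (simp_all add: form_coeffs_def)

text \<open>
  Here \<open>(1 + \<lambda>\<^sub>1\<^sub>2) / 2 = e z\<^sub>1\<close>, \<open>(1 - \<lambda>\<^sub>2\<^sub>3) / 2 = e z\<^sub>2\<close> and \<open>(1 - \<lambda>\<^sub>1\<^sub>3) / 2 = g z\<^sub>2\<close>.  With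
  \<open>a = v\<^sub>2 - v\<^sub>1\<close> and \<open>b = v\<^sub>3 - v\<^sub>2\<close>, the adapted coordinates are \<open>Y = g a + f b\<close>,
  \<open>Z = z\<^sub>1 a + z\<^sub>2 b\<close> and \<open>X = v\<^sub>2 - k Y + m Z\<close>; \<open>x'\<close>, \<open>y'\<close>, \<open>z'\<close> express the \<open>v\<^sub>i\<close> through them.
\<close>

lemma polynomial_presentation_parametrized:
  fixes q e f g z1 z2 :: complex
  assumes q: "q\<^sup>2 + 1 \<noteq> 0"
    and det: "g * z2 - f * z1 = 1" and g: "g = e + f"
  shows "polynomial_presentation
           (A'_relators q (2 * (e * z1) - 1) (2 * (1 - g * z2) - 1) (2 * (1 - e * z2) - 1))"
proof -
  \<comment> \<open>Under \<open>det\<close>,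
    \<open>e (z2^2 b^2 - z1^2 a^2) = m Z^2 - k (Y Z + Z Y)\<close> for \<open>a = v2 - v1\<close>
    and \<open>b = v3 - v2\<close>. The correction of \<open>v2\<close> to \<open>X\<close> absorbs
    this right-hand side.\<close>
  define k where "k = e * z1 * z2"
  define m where "m = e * (z1 * f + z2 * g)"
  define x where "x = form_coeffs (k * g + m * - z1) (1 - k * e + m * (z1 - z2)) (- k * f + m * z2)"
  define y where "y = form_coeffs (- g) e f"
  define z where "z = form_coeffs (- z1) (z1 - z2) z2"
  \<comment> \<open>By \<open>det\<close>, \<open>a = z2 Y - f Z\<close> and
    \<open>b = - z1 Y + g Z\<close>; moreover \<open>v2 = X + k Y - m Z\<close>.\<close>
  define x' :: "index \<Rightarrow> complex" where "x' = form_coeffs 1 1 1"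
  define y' where "y' = form_coeffs (k - z2) k (k - z1)"
  define z' where "z' = form_coeffs (f - m) (- m) (g - m)"
  \<comment> \<open>The factor \<open>e f g\<close> is the coefficient of \<open>Z^2\<close> in
    \<open>e (f z2 b^2 - g z1 a^2) = - k Y^2 + e f g Z^2\<close>.\<close>
  let ?c = "(q\<^sup>2 - 1) * e * f * g"
  let ?X = "linear_form x" and ?Y = "linear_form y" and ?Z = "linear_form z"
  let ?P1 = "?Y * ?Z - const (q\<^sup>2) * (?Z * ?Y)"
  let ?P2 = "?Z * ?X - const (q\<^sup>2) * (?X * ?Z)"
  let ?P3 = "?Y * ?X - const (q\<^sup>2) * (?X * ?Y) - const ?c * (?Z * ?Z)"
  let ?T1 = "skew_relator (q\<^sup>2) (e * z1) I1 I2"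
  let ?T3 = "skew_relator (q\<^sup>2) (1 - g * z2) I1 I3"
  let ?T2 = "skew_relator (q\<^sup>2) (1 - e * z2) I2 I3"
  define S where "S = A'_relators q (2 * (e * z1) - 1) (2 * (1 - g * z2) - 1) (2 * (1 - e * z2) - 1)"
  note defs = x_def y_def z_def x'_def y'_def z'_def
  \<comment> \<open>\<open>v2\<close> cancels on the right, which leaves a quadratic relation in
    \<open>a\<close> and \<open>b\<close>; \<open>det\<close> and \<open>g = e + f\<close> factor
    it.\<close>
  have P1: "?P1 = ?T3 - ?T1 - ?T2"
    unfolding skew_relator_def Let_def form_simps
    by (rule bilinear_form_eqI; simp only: defs form_coeffs_simps unit_coeffs_simps g m_def k_def;
        ((use det[unfolded g] in Groebner_Basis.algebra) | (simp add: algebra_simps)))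
  have P2: "?P2 = const z1 * ?T1 + const z2 * ?T2 + const k * ?P1"
    unfolding skew_relator_def Let_def form_simps
    by (rule bilinear_form_eqI; simp only: defs form_coeffs_simps unit_coeffs_simps g m_def k_def;
        ((use det[unfolded g] in Groebner_Basis.algebra) | (simp add: algebra_simps)))
  have P3: "?P3 = const g * ?T1 + const f * ?T2 + const m * ?P1"
    unfolding skew_relator_def Let_def form_simps
    by (rule bilinear_form_eqI; simp only: defs form_coeffs_simps unit_coeffs_simps g m_def k_def;
        ((use det[unfolded g] in Groebner_Basis.algebra) | (simp add: algebra_simps)))
  \<comment> \<open>\<open>P2\<close> and \<open>P3\<close> modulo \<open>P1\<close> form a 2 by 2
    linear system in \<open>T1\<close> and \<open>T2\<close>; by \<open>det\<close> its determinant
    is -1, so the inverse has polynomial entries.\<close>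
  have T1: "?T1 = const z2 * ?P3 + const (- f) * ?P2 + const (f * k - z2 * m) * ?P1"
    unfolding skew_relator_def Let_def form_simps
    by (rule bilinear_form_eqI; simp only: defs form_coeffs_simps unit_coeffs_simps g m_def k_def;
        ((use det[unfolded g] in Groebner_Basis.algebra) | (simp add: algebra_simps)))
  have T2: "?T2 = const (- z1) * ?P3 + const g * ?P2 + const (z1 * m - g * k) * ?P1"
    unfolding skew_relator_def Let_def form_simps
    by (rule bilinear_form_eqI; simp only: defs form_coeffs_simps unit_coeffs_simps g m_def k_def;
        ((use det[unfolded g] in Groebner_Basis.algebra) | (simp add: algebra_simps)))
  have T3: "?T3 = ?P1 + ?T1 + ?T2"
    unfolding P1 by simp
  define h where "h = 2 / (q\<^sup>2 + 1)"
  have h: "h \<noteq> 0" using q by (simp add: h_def)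
  have S: "S = {const h * ?T1, const h * ?T3, const h * ?T2}"
    by (simp only: S_def A'_relators_def relator_eq_skew_relator[OF q] h_def)
  have T_in: "t \<in> relation_ideal S" if "const h * t \<in> S" for t
    using relation_ideal_mult_left[OF relation_ideal_base[OF that], of "const (inverse h)"] h
    by (simp add: const_const_mult)
  have T_in: "?T1 \<in> relation_ideal S" "?T2 \<in> relation_ideal S" "?T3 \<in> relation_ideal S"
    by (rule T_in; simp only: S insert_iff simp_thms)+
  have P1_in: "?P1 \<in> relation_ideal S"
    unfolding P1 by (intro relation_ideal_diff T_in)
  have gen: "gen a = const (x' a) * ?X + const (y' a) * ?Y + const (z' a) * ?Z" for a
  proof -
    have "gen I1 = const (x' I1) * ?X + const (y' I1) * ?Y + const (z' I1) * ?Z"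
      "gen I2 = const (x' I2) * ?X + const (y' I2) * ?Y + const (z' I2) * ?Z"
      "gen I3 = const (x' I3) * ?X + const (y' I3) * ?Y + const (z' I3) * ?Z"
      unfolding gen_eq_linear_form form_simps
      by (rule linear_form_eqI; simp only: defs form_coeffs_simps unit_coeffs_simps g m_def k_def;
          ((use det[unfolded g] in Groebner_Basis.algebra) | (simp add: algebra_simps)))+
    then show ?thesis by (cases a) (simp_all only:)
  qed
  have "skew_presentation S x y z x' y' z' (q\<^sup>2) ?c ?X ?Y ?Z ?P1 ?P2 ?P3"
  proof (unfold_locales, goal_cases)
    case 7
    show ?case by (rule P1_in)
  next
    case 8
    show ?case unfolding P2 by (intro relation_ideal_add relation_ideal_mult_left T_in P1_in)
  next
    case 9
    show ?case unfolding P3 by (intro relation_ideal_add relation_ideal_mult_left T_in P1_in)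
  next
    case (10 s)
    have R1: "const h * ?T1 = const (h * (f * k - z2 * m)) * ?P1 + const (h * - f) * ?P2
        + const (h * z2) * ?P3"
      by (subst T1) (simp only: const_const_mult distrib_left add_ac)
    have R2: "const h * ?T2 = const (h * (z1 * m - g * k)) * ?P1 + const (h * g) * ?P2
        + const (h * - z1) * ?P3"
      by (subst T2) (simp only: const_const_mult distrib_left add_ac)
    have R3: "const h * ?T3 = const (h + h * (f * k - z2 * m) + h * (z1 * m - g * k)) * ?P1
        + const (h * - f + h * g) * ?P2 + const (h * z2 + h * - z1) * ?P3"
      unfolding T3 distrib_left R1 R2 const_add distrib_right by (simp only: add_ac)
    from 10 have "s \<in> {const h * ?T1, const h * ?T3, const h * ?T2}"
      unfolding S .
    then show ?case using R1 R2 R3 by blast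
  next
    case (11 a)
    show ?case by (rule gen)
  qed (simp_all only: refl, simp_all add: defs g m_def k_def, insert det[unfolded g],
      ((Groebner_Basis.algebra | simp add: algebra_simps)+))
  then show ?thesis unfolding S_def[symmetric] by (rule skew_presentation.skew_polynomial_presentation)
qed

text \<open>In terms of \<open>s\<close>, \<open>t\<close>, \<open>m\<close> below one has to solve
  \<open>e * z1 = s\<close>, \<open>e * z2 = t\<close>, \<open>g * z2 = m\<close>,
  \<open>f * z1 = m - 1\<close> and \<open>g = e + f\<close>; the determinant is then 1. The
  hypothesis on the parameters becomes \<open>rel\<close>. If \<open>s\<close> or \<open>t\<close>
  is nonzero, \<open>e\<close> can be scaled to 1.\<close>

lemma parametrization_exists:
  fixes l12 l13 l23 :: complex
  assumes "l12 * l23 - l12 * l13 - l13 * l23 = -1"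
  obtains e f g z1 z2 where "g * z2 - f * z1 = 1" "g = e + f"
    "l12 = 2 * (e * z1) - 1" "l13 = 2 * (1 - g * z2) - 1" "l23 = 2 * (1 - e * z2) - 1"
proof -
  define s t m where "s = (1 + l12) / 2" and "t = (1 - l23) / 2" and "m = (1 - l13) / 2"
  have l: "l12 = 2 * s - 1" "l23 = 1 - 2 * t" "l13 = 1 - 2 * m"
    by (simp_all add: s_def t_def m_def field_simps)
  have "4 * (m * s - t * s + t * (1 - m)) = 0"
    using assms unfolding l by Groebner_Basis.algebra
  then have rel: "m * s - t * s + t * (1 - m) = 0"
    by (metis mult_eq_0_iff zero_neq_numeral)
  consider "s \<noteq> 0" | "s = 0" "t \<noteq> 0" | "s = 0" "t = 0" by blast
  then show ?thesis
  proof cases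
    case 1
    define f where "f = - (1 - m) / s"
    have fs: "f * s = m - 1" using 1 by (simp add: f_def)
    have "((1 + f) * t - m) * s = 0" using rel fs by Groebner_Basis.algebra
    then have "(1 + f) * t = m" using 1 by simp
    with fs show ?thesis
      \<comment> \<open>The instances stand for \<open>g\<close>, \<open>z2\<close>,
        \<open>f\<close>, \<open>z1\<close>, \<open>e\<close>, in this order.\<close>
      by (intro that[of "1 + f" t f s 1]) (simp_all add: l)
  next
    case 2
    then have "m = 1" using rel by simp
    with 2 show ?thesis
      by (intro that[of "m / t" t "(m - t) / t" s 1]) (simp_all add: l field_simps)
  next
    case 3
    \<comment> \<open>Here \<open>e = 0\<close>, so that \<open>f = g\<close>, scaled to 1.\<close>
    show ?thesis
      by (rule that[of 1 m 1 "m - 1" 0]) (use 3 in \<open>simp_all add: l\<close>)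
  qed
qed

theorem proposition7:
  fixes q l12 l13 l23 :: complex
  assumes "norm q = 1"
    and "q \<noteq> 1" and "q \<noteq> -1" and "q \<noteq> \<i>" and "q \<noteq> -\<i>"
    and "l12 * l23 - l12 * l13 - l13 * l23 = -1"
  shows "polynomial_presentation (A'_relators q l12 l13 l23)"
proof -
  have "q\<^sup>2 + 1 = (q - \<i>) * (q + \<i>)"
    by (simp add: algebra_simps power2_eq_square)
  then have "q\<^sup>2 + 1 \<noteq> 0"
    using assms(4,5) by (simp add: eq_neg_iff_add_eq_0)
  moreover obtain e f g z1 z2 where "g * z2 - f * z1 = 1" "g = e + f"
    "l12 = 2 * (e * z1) - 1" "l13 = 2 * (1 - g * z2) - 1" "l23 = 2 * (1 - e * z2) - 1"
    using parametrization_exists[OF assms(6)] by metis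
  ultimately show ?thesis
    using polynomial_presentation_parametrized by metis
qed

end
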